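(* Let $A,B\in\mathbb R^{\mathcal N\times\mathcal N}$ with $A$ invertible, and assume that among the generalized eigenvalues $\lambda\in\mathbb C$ of $Av=\lambda Bv$ there is a unique positive one $\lambda>0$ of smallest modulus, and that it is simple. Let $u,u^*$, $k$, $M$, $\tilde u^*$, $P$, $P^*$ be as in the context. Let $u_N,u_N^*\in\mathbb R^{\mathcal N}$ with $\langle u_N^*,Au_N\rangle\neq0$, and let $k_N:=\frac{\langle u_N^*,Bu_N\rangle}{\langle u_N^*,Au_N\rangle}$ satisfy $k_N\notin\sigma\big((PMP)|_{[\operatorname{Span}\{\tilde u^*\}]^\perp}\big)$ and $k_N\notin\sigma\big((P^*M^TP^* )|_{[\operatorname{Span}\{u\}]^\perp}\big)$. Let $R_N=(B-k_NA)u_N$, $R_N^*=(B^T-k_NA^T)u_N^*$. Then $$|k_N-k|\le C_N^k\,\eta_N^k,\qquad \eta_N^k:=\frac{\|R_N\|\,\|R_N^*\|}{|\langle u_N^*,Au_N\rangle|},$$ where $$C_N^k:=\Big\|\big[P^*(P^*M^TP^*-k_NI)^+P^*\big]^T(M-kI)P(PMP-k_NI)^+PA^{-1}\Big\|.$$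
   Context: $\mathbb R^{\mathcal N}$ carries the Euclidean inner product $\langle\cdot,\cdot\rangle$ and norm $\|\cdot\|$; on matrices $\|\cdot\|$ is the induced operator norm. "Simple" means $k=1/\lambda$ is an algebraically simple eigenvalue of $M=A^{-1}B$. $u,u^*$ are unit vectors with $Au=\lambda Bu$, $A^Tu^*=\lambda B^Tu^*$; $\tilde u^*=A^Tu^*/\|A^Tu^*\|$; $P=I-\frac{u(\tilde u^* )^T}{\langle u,\tilde u^*\rangle}$, $P^*=I-\frac{\tilde u^*u^T}{\langle u,\tilde u^*\rangle}$ (here $\langle u,\tilde u^*\rangle\ne0$). The operator $(PMP-k_NI)^+$ is the linear map equal to the inverse of $(PMP-k_NI)|_{[\operatorname{Span}\{\tilde u^*\}]^\perp}$ (an invertible map of $[\operatorname{Span}\{\tilde u^*\}]^\perp$ onto itself) on $[\operatorname{Span}\{\tilde u^*\}]^\perp$ and equal to $0$ on $\operatorname{Span}\{u\}$; likewise $(P^*M^TP^*-k_NI)^+$ equals the inverse of $(P^*M^TP^*-k_NI)|_{[\operatorname{Span}\{u\}]^\perp}$ on $[\operatorname{Span}\{u\}]^\perp$ and $0$ on $\operatorname{Span}\{\tilde u^*\}$. *)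

theory Defs
  imports "HOL-Analysis.Analysis" "HOL-Computational_Algebra.Polynomial"
begin

text \<open>Complexification of a real matrix.\<close>
definition cmat :: "real^'n^'m \<Rightarrow> complex^'n^'m" where
  "cmat A = (\<chi> i j. complex_of_real (A $ i $ j))"

text \<open>Generalized eigenvalue (over the complex numbers) of the pencil A v = lambda B v.\<close>
definition gen_eigenvalue :: "real^'n^'n \<Rightarrow> real^'n^'n \<Rightarrow> complex \<Rightarrow> bool" where
  "gen_eigenvalue A B l \<longleftrightarrow>
     (\<exists>v::complex^'n. v \<noteq> 0 \<and> cmat A *v v = l *s (cmat B *v v))"

text \<open>Characteristic polynomial det(X I - M).\<close>
definition charpoly :: "real^'n^'n \<Rightarrow> real poly" where
  "charpoly M = det (\<chi> i j. (if i = j then [:0, 1:] else 0) - [: M $ i $ j :])"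

text \<open>Algebraically simple eigenvalue: root of multiplicity one of the characteristic polynomial.\<close>
definition alg_simple_eigenvalue :: "real^'n^'n \<Rightarrow> real \<Rightarrow> bool" where
  "alg_simple_eigenvalue M k \<longleftrightarrow> order k (charpoly M) = 1"

text \<open>Outer product x y^T.\<close>
definition outer :: "real^'n \<Rightarrow> real^'n \<Rightarrow> real^'n^'n" where
  "outer x y = (\<chi> i j. x $ i * y $ j)"

text \<open>mu is in the spectrum of T restricted to the hyperplane w^perp
  (T is assumed to leave w^perp invariant in the application).\<close>
definition restr_eigenvalue :: "real^'n^'n \<Rightarrow> real^'n \<Rightarrow> real \<Rightarrow> bool" where
  "restr_eigenvalue T w mu \<longleftrightarrow> (\<exists>y. y \<noteq> 0 \<and> y \<bullet> w = 0 \<and> T *v y = mu *s y)"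

text \<open>The map equal to the inverse of T restricted to w^perp on w^perp and zero on span z.\<close>
definition restr_pinv :: "real^'n^'n \<Rightarrow> real^'n \<Rightarrow> real^'n \<Rightarrow> real^'n^'n" where
  "restr_pinv T w z = (THE X. (\<forall>y. y \<bullet> w = 0 \<longrightarrow> (X *v y) \<bullet> w = 0 \<and> T *v (X *v y) = y)
                              \<and> X *v z = 0)"

end

theory Submission
  imports Defs
begin

(*
  Write M = A^-1 B and k = 1/lam.  The residuals are R_N = A (M - k_N I) u_N and
  R_N^* = (M^T - k_N I) v with v = A^T u_N^*.  The reduced resolvents
  R = P (P M P - k_N I)^+ P and R^* = P^* (P^* M^T P^* - k_N I)^+ P^* invert M - k_N I and
  M^T - k_N I up to the oblique projections P and P^*, which commute with M and M^T.
  Since M - k I kills u and its range is orthogonal to A^T u^*, this yields the exact identity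
    <R_N^*, C R_N> = <v, (M - k I) u_N> = (k_N - k) <u_N^*, A u_N>,
  where C is the matrix whose norm is C_N^k, and Cauchy-Schwarz gives the bound.

  The projections are well defined because the right and left eigenvectors u and A^T u^*
  of a simple eigenvalue are not orthogonal: the derivative of the characteristic polynomial
  at k is the trace of the cofactor matrix of k I - M, whose rows are multiples of u and
  whose columns are multiples of A^T u^*, so it vanishes if u is orthogonal to A^T u^*.
*)

section \<open>Cofactors\<close>

lemma det_eq_0_iff_kernel:
  fixes N :: "real^'n^'n"
  shows "det N = 0 \<longleftrightarrow> (\<exists>u. u \<noteq> 0 \<and> N *v u = 0)"
  using det_nz_iff_inj[of "(*v) N"] linear_inj_iff_eq_0[of "(*v) N"] by auto

definition replace_row :: "'a::comm_ring_1^'n^'n \<Rightarrow> 'n \<Rightarrow> 'a^'n \<Rightarrow> 'a^'n^'n" where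
  "replace_row N i v = (\<chi> r. if r = i then v else row r N)"

text \<open>\<^term>\<open>det (replace_row N i (axis j 1))\<close> is the \<open>(i, j)\<close> cofactor of \<^term>\<open>N\<close>.\<close>

lemma det_replace_row_linear:
  fixes N :: "real^'n^'n"
  shows "det (replace_row N i (a *s v + b *s v')) = a * det (replace_row N i v) + b * det (replace_row N i v')"
  unfolding replace_row_def
  using det_row_add[of i "\<lambda>_. a *s v" "\<lambda>_. b *s v'" "\<lambda>r. row r N"]
    det_row_mul[of i a "\<lambda>_. v" "\<lambda>r. row r N"] det_row_mul[of i b "\<lambda>_. v'" "\<lambda>r. row r N"]
  by simp

lemma det_replace_row_orthogonal_kernel:
  fixes N :: "real^'n^'n"
  assumes "N *v u = 0" "u \<noteq> 0" "v \<bullet> u = 0"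
  shows "det (replace_row N i v) = 0"
proof -
  have "replace_row N i v *v u = 0"
    using assms unfolding replace_row_def
    by (auto simp: vec_eq_iff matrix_vector_mult_def row_def inner_vec_def mult.commute)
  with \<open>u \<noteq> 0\<close> show ?thesis
    by (auto simp: det_eq_0_iff_kernel)
qed

lemma det_replace_row_kernel:
  fixes N :: "real^'n^'n"
  assumes "N *v u = 0" "u \<noteq> 0"
  shows "det (replace_row N i v) = (v \<bullet> u) / (u \<bullet> u) * det (replace_row N i u)"
proof -
  define c where "c = (v \<bullet> u) / (u \<bullet> u)"
  have "v = 1 *s (v - c *s u) + c *s u"
    by (simp add: vec_eq_iff)
  then have "det (replace_row N i v) = det (replace_row N i (v - c *s u)) + c * det (replace_row N i u)"
    by (metis det_replace_row_linear mult_1)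
  moreover have "(v - c *s u) \<bullet> u = 0"
    using \<open>u \<noteq> 0\<close> by (simp add: c_def scalar_mult_eq_scaleR inner_diff_left)
  ultimately show ?thesis
    using det_replace_row_orthogonal_kernel[OF assms] by (simp add: c_def)
qed

lemma prod_replace_row_axis:
  fixes N :: "real^'n^'n"
  shows "(\<Prod>r\<in>UNIV. replace_row N i (axis j 1) $ r $ p r)
       = (if p i = j then \<Prod>r\<in>UNIV - {i}. N $ r $ p r else 0)"
  by (simp add: prod.remove[of UNIV i] replace_row_def row_def axis_def)

lemma det_replace_row_axis_transpose:
  fixes N :: "real^'n^'n"
  shows "det (replace_row N i (axis j 1)) = det (replace_row (transpose N) j (axis i 1))"
proof -
  define K :: "real^'n^'n" where "K = (\<chi> r s. if s = j then (if r = i then 1 else 0) else N $ r $ s)"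
  have "(\<Prod>r\<in>UNIV. replace_row N i (axis j 1) $ r $ p r) = (\<Prod>r\<in>UNIV. K $ r $ p r)"
    if p: "p permutes UNIV" for p
  proof (cases "p i = j")
    case True
    have "p r \<noteq> j" if "r \<noteq> i" for r
      using p that True by (metis permutes_inj injD)
    then show ?thesis
      using True by (simp add: prod_replace_row_axis prod.remove[of UNIV i] K_def)
  next
    case False
    obtain r where "p r = j"
      using p by (metis permutes_surj surjD)
    then have "K $ r $ p r = 0"
      using False by (auto simp: K_def)
    then show ?thesis
      using False by (simp add: prod_replace_row_axis) blast
  qed
  then have "det (replace_row N i (axis j 1)) = det K"
    unfolding det_def by (intro sum.cong) auto
  also have "\<dots> = det (transpose K)"
    by simp
  also have "transpose K = replace_row (transpose N) j (axis i 1)"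
    by (simp add: K_def replace_row_def vec_eq_iff transpose_def row_def axis_def)
  finally show ?thesis .
qed

lemma sum_det_replace_row_axis_eq_0:
  fixes N :: "real^'n^'n"
  assumes Nu: "N *v u = 0" and "u \<noteq> 0" and wN: "w v* N = 0" and "w \<noteq> 0" and "u \<bullet> w = 0"
  shows "(\<Sum>i\<in>UNIV. det (replace_row N i (axis i 1))) = 0"
proof -
  obtain j where j: "u $ j \<noteq> 0"
    using \<open>u \<noteq> 0\<close> by (metis vec_eq_iff zero_index)
  have NTw: "transpose N *v w = 0"
    using wN by simp
  \<comment> \<open>The \<open>(i, j)\<close> cofactor is proportional to \<open>u $ j\<close> (expanding along row \<open>i\<close>) and
    to \<open>w $ i\<close> (expanding along column \<open>j\<close>), so the diagonal ones are proportional to \<open>u $ i * w $ i\<close>.\<close>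
  define c where "c = det (replace_row (transpose N) j w) / (w \<bullet> w) / u $ j"
  have "det (replace_row N i (axis i 1)) = u $ i * w $ i * c" for i
  proof -
    have "u $ j / (u \<bullet> u) * det (replace_row N i u) = det (replace_row N i (axis j 1))"
      using det_replace_row_kernel[OF Nu \<open>u \<noteq> 0\<close>, of i "axis j 1"] by (simp add: inner_axis')
    also have "\<dots> = w $ i / (w \<bullet> w) * det (replace_row (transpose N) j w)"
      using det_replace_row_kernel[OF NTw \<open>w \<noteq> 0\<close>, of j "axis i 1"]
      unfolding det_replace_row_axis_transpose[of N] by (simp add: inner_axis' del: transpose_matrix_vector)
    finally have "det (replace_row N i u) = (u \<bullet> u) * w $ i * c"
      using j \<open>u \<noteq> 0\<close> \<open>w \<noteq> 0\<close> by (simp add: c_def field_simps)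
    then show ?thesis
      using det_replace_row_kernel[OF Nu \<open>u \<noteq> 0\<close>, of i "axis i 1"] \<open>u \<noteq> 0\<close>
      by (simp add: inner_axis')
  qed
  then have "(\<Sum>i\<in>UNIV. det (replace_row N i (axis i 1))) = (u \<bullet> w) * c"
    by (simp add: inner_vec_def sum_distrib_right)
  then show ?thesis
    using \<open>u \<bullet> w = 0\<close> by simp
qed

section \<open>Eigenvectors of a simple eigenvalue\<close>

lemma poly_charpoly:
  fixes M :: "real^'n^'n"
  shows "poly (charpoly M) x = det (x *\<^sub>R mat 1 - M)"
proof -
  define F :: "real poly^'n^'n" where "F = (\<chi> i j. (if i = j then [:0, 1:] else 0) - [: M $ i $ j :])"
  have "poly (F $ i $ j) x = (x *\<^sub>R mat 1 - M) $ i $ j" for i j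
    by (simp add: F_def mat_def)
  then show ?thesis
    unfolding charpoly_def det_def F_def[symmetric] by (simp add: poly_sum poly_prod of_int_poly)
qed

lemma poly_pderiv_charpoly:
  fixes M :: "real^'n^'n"
  shows "poly (pderiv (charpoly M)) x = (\<Sum>i\<in>UNIV. det (replace_row (x *\<^sub>R mat 1 - M) i (axis i 1)))"
proof -
  define N where "N = x *\<^sub>R mat 1 - M"
  define F :: "real poly^'n^'n" where "F = (\<chi> i j. (if i = j then [:0, 1:] else 0) - [: M $ i $ j :])"
  have pderiv_F: "pderiv (F $ i $ j) = [:of_bool (i = j):]" for i j
    by (simp add: F_def pderiv_diff pderiv_pCons)
  have poly_F: "poly (F $ i $ j) x = N $ i $ j" for i j
    by (simp add: F_def N_def mat_def)
  have "poly (pderiv (charpoly M)) x =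
     (\<Sum>p | p permutes UNIV. of_int (sign p) *
        (\<Sum>i | i = p i. \<Prod>r\<in>UNIV - {i}. N $ r $ p r))"
    unfolding charpoly_def det_def F_def[symmetric]
    by (simp add: higher_pderiv_sum[of 1, simplified] pderiv_mult pderiv_smult of_int_poly pderiv_pCons
        pderiv_prod poly_sum poly_prod pderiv_F poly_F)
  also have "\<dots> = (\<Sum>p | p permutes UNIV. \<Sum>i\<in>UNIV.
      of_int (sign p) * (\<Prod>r\<in>UNIV. replace_row N i (axis i 1) $ r $ p r))"
    by (simp add: prod_replace_row_axis sum_distrib_left if_distrib sum.If_cases eq_commute)
  also have "\<dots> = (\<Sum>i\<in>UNIV. det (replace_row N i (axis i 1)))"
    unfolding det_def by (rule sum.swap)
  finally show ?thesis
    by (simp add: N_def)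
qed

lemma charpoly_nonzero:
  fixes M :: "real^'n^'n"
  shows "charpoly M \<noteq> 0"
proof
  define t where "t = onorm ((*v) M) + 1"
  assume "charpoly M = 0"
  then have "det (t *\<^sub>R mat 1 - M) = 0"
    by (metis poly_0 poly_charpoly)
  then obtain v where "v \<noteq> 0" and "M *v v = t *\<^sub>R v"
    by (auto simp: det_eq_0_iff_kernel matrix_vector_mult_diff_rdistrib scaleR_matrix_vector_assoc[symmetric])
  moreover have "0 \<le> onorm ((*v) M)"
    by (simp add: onorm_pos_le)
  ultimately have "t * norm v \<le> onorm ((*v) M) * norm v"
    using onorm[of "(*v) M" v] by (simp add: t_def)
  with \<open>v \<noteq> 0\<close> show False
    by (simp add: t_def)
qed

lemma poly_pderiv_nonzero_if_order_1:
  fixes p :: "'a::{idom,ring_char_0} poly"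
  assumes "p \<noteq> 0" and "order a p = 1"
  shows "poly (pderiv p) a \<noteq> 0"
proof
  assume pderiv_root: "poly (pderiv p) a = 0"
  have root: "poly p a = 0"
    using assms by (simp add: order_root)
  then have "order a (pderiv p) = 0"
    using order_pderiv[OF \<open>p \<noteq> 0\<close>] assms(2) by simp
  then have "degree p = 0"
    using pderiv_root order_root pderiv_eq_0_iff by blast
  then show False
    using root \<open>p \<noteq> 0\<close> by (metis degree_0_id poly_pCons mult_zero_right add_0_right poly_0 pCons_0_0)
qed

lemma alg_simple_eigenvalue_eigenvectors_not_orthogonal:
  fixes M :: "real^'n^'n"
  assumes "alg_simple_eigenvalue M k"
    and "M *v u = k *\<^sub>R u" and "u \<noteq> 0" and "w v* M = k *\<^sub>R w" and "w \<noteq> 0"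
  shows "u \<bullet> w \<noteq> 0"
proof
  define N where "N = k *\<^sub>R mat 1 - M"
  assume "u \<bullet> w = 0"
  have "N *v u = 0"
    using assms(2) by (simp add: N_def matrix_vector_mult_diff_rdistrib scaleR_matrix_vector_assoc[symmetric])
  moreover have "w v* N = 0"
    using assms(4) by (simp add: N_def vector_matrix_mult_diff_rdistrib vector_scaleR_matrix_ac)
  ultimately have "poly (charpoly M) k = 0" and "poly (pderiv (charpoly M)) k = 0"
    using \<open>u \<noteq> 0\<close> \<open>w \<noteq> 0\<close> \<open>u \<bullet> w = 0\<close> sum_det_replace_row_axis_eq_0
    by (auto simp: poly_charpoly poly_pderiv_charpoly det_eq_0_iff_kernel N_def[symmetric])
  then show False
    using assms(1) charpoly_nonzero poly_pderiv_nonzero_if_order_1 unfolding alg_simple_eigenvalue_def by blast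
qed

section \<open>Oblique projections and restricted inverses\<close>

lemma outer_mult_vector: "outer x y *v v = (y \<bullet> v) *\<^sub>R x"
  by (simp add: outer_def matrix_vector_mult_def vec_eq_iff inner_vec_def sum_distrib_left mult_ac)

text \<open>The projection onto the orthogonal complement of \<^term>\<open>w\<close> along \<^term>\<open>u\<close>; the paper's
  \<open>P\<close> and \<open>P\<^sup>*\<close> are \<open>oblique_proj u ut\<close> and \<open>oblique_proj ut u\<close>.\<close>

definition oblique_proj :: "real^'n \<Rightarrow> real^'n \<Rightarrow> real^'n^'n" where
  "oblique_proj u w = mat 1 - (1 / (u \<bullet> w)) *\<^sub>R outer u w"

lemma oblique_proj_apply: "oblique_proj u w *v v = v - ((w \<bullet> v) / (u \<bullet> w)) *\<^sub>R u"
  by (simp add: oblique_proj_def matrix_vector_mult_diff_rdistrib outer_mult_vector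
      scaleR_matrix_vector_assoc[symmetric])

lemma oblique_proj_orthogonal: "u \<bullet> w \<noteq> 0 \<Longrightarrow> (oblique_proj u w *v v) \<bullet> w = 0"
  by (simp add: oblique_proj_apply inner_diff_left inner_commute[of w v])

lemma oblique_proj_id: "v \<bullet> w = 0 \<Longrightarrow> oblique_proj u w *v v = v"
  by (simp add: oblique_proj_apply inner_commute)

lemma oblique_proj_idem:
  "u \<bullet> w \<noteq> 0 \<Longrightarrow> oblique_proj u w *v (oblique_proj u w *v v) = oblique_proj u w *v v"
  by (simp add: oblique_proj_id oblique_proj_orthogonal)

lemma oblique_proj_commute:
  assumes "M *v u = k *\<^sub>R u" and "w v* M = k *\<^sub>R w"
  shows "oblique_proj u w *v (M *v v) = M *v (oblique_proj u w *v v)"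
proof -
  have "w \<bullet> (M *v v) = k * (w \<bullet> v)"
    using assms(2) by (metis dot_lmul_matrix inner_scaleR_left)
  then show ?thesis
    using assms(1) by (simp add: oblique_proj_apply matrix_vector_mult_diff_distrib matrix_vector_mult_scaleR)
qed

context
  fixes T :: "real^'n^'n" and w z :: "real^'n"
  assumes z_w: "z \<bullet> w \<noteq> 0"
    and invariant: "\<And>y. y \<bullet> w = 0 \<Longrightarrow> (T *v y) \<bullet> w = 0"
    and injective: "\<And>y. y \<bullet> w = 0 \<Longrightarrow> T *v y = 0 \<Longrightarrow> y = 0"
begin

lemma restr_pinv_exists:
  "\<exists>X. (\<forall>y. y \<bullet> w = 0 \<longrightarrow> (X *v y) \<bullet> w = 0 \<and> T *v (X *v y) = y) \<and> X *v z = 0"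
proof -
  define Q where "Q = oblique_proj z w"
  \<comment> \<open>\<open>T'\<close> acts as \<open>T\<close> on the complement of \<open>w\<close> and fixes \<open>z\<close>; it is invertible, and
    \<open>T'\<^sup>-\<^sup>1 Q\<close> is the restricted inverse.\<close>
  define T' where "T' = T ** Q + (1 / (z \<bullet> w)) *\<^sub>R outer z w"
  have T'_apply: "T' *v v = T *v (Q *v v) + ((w \<bullet> v) / (z \<bullet> w)) *\<^sub>R z" for v
    by (simp add: T'_def matrix_vector_mult_add_rdistrib outer_mult_vector
        scaleR_matrix_vector_assoc[symmetric] matrix_vector_mul_assoc)
  have w_T': "(T' *v v) \<bullet> w = w \<bullet> v" for v
    using z_w by (simp add: T'_apply inner_add_left invariant Q_def oblique_proj_orthogonal)
  have "inj ((*v) T')"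
  proof (rule injI)
    fix x y
    assume "T' *v x = T' *v y"
    then have T'_d: "T' *v (x - y) = 0"
      by (simp add: matrix_vector_mult_diff_distrib)
    then have "w \<bullet> (x - y) = 0"
      using w_T' by (metis inner_zero_left)
    then show "x = y"
      using T'_d injective[of "x - y"] by (simp add: T'_apply Q_def oblique_proj_id inner_commute)
  qed
  then obtain B where "B ** T' = mat 1"
    using matrix_left_invertible_injective by blast
  then have T'_B: "T' ** B = mat 1"
    using matrix_left_right_inverse by blast
  show ?thesis
  proof (intro exI conjI allI impI)
    fix y
    assume "y \<bullet> w = 0"
    have "T' *v (B *v y) = y"
      using T'_B by (simp add: matrix_vector_mul_assoc)
    moreover from this have "w \<bullet> (B *v y) = 0"
      using w_T' \<open>y \<bullet> w = 0\<close> by metis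
    ultimately show "((B ** Q) *v y) \<bullet> w = 0" and "T *v ((B ** Q) *v y) = y"
      using \<open>y \<bullet> w = 0\<close>
      by (simp_all add: T'_apply Q_def oblique_proj_id inner_commute matrix_vector_mul_assoc[symmetric])
  next
    show "(B ** Q) *v z = 0"
      using z_w by (simp add: Q_def oblique_proj_apply inner_commute matrix_vector_mul_assoc[symmetric])
  qed
qed

lemma restr_pinv_unique:
  assumes "(\<forall>y. y \<bullet> w = 0 \<longrightarrow> (X1 *v y) \<bullet> w = 0 \<and> T *v (X1 *v y) = y) \<and> X1 *v z = 0"
    and "(\<forall>y. y \<bullet> w = 0 \<longrightarrow> (X2 *v y) \<bullet> w = 0 \<and> T *v (X2 *v y) = y) \<and> X2 *v z = 0"
  shows "X1 = X2"
proof -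
  define Q where "Q = oblique_proj z w"
  have "X1 *v v = X2 *v v" for v
  proof -
    have split: "v = Q *v v + ((w \<bullet> v) / (z \<bullet> w)) *\<^sub>R z"
      by (simp add: Q_def oblique_proj_apply)
    have "X *v v = X *v (Q *v v)" if "X *v z = 0" for X :: "real^'n^'n"
      by (subst split) (simp add: matrix_vector_right_distrib matrix_vector_mult_scaleR that)
    moreover have "X1 *v (Q *v v) = X2 *v (Q *v v)"
      using assms injective[of "X1 *v (Q *v v) - X2 *v (Q *v v)"] z_w
      by (simp add: Q_def oblique_proj_orthogonal inner_diff_left matrix_vector_mult_diff_distrib)
    ultimately show ?thesis
      using assms by simp
  qed
  then show ?thesis
    by (simp add: matrix_eq)
qed

lemma restr_pinv_spec:
  "(\<forall>y. y \<bullet> w = 0 \<longrightarrow> (restr_pinv T w z *v y) \<bullet> w = 0 \<and> T *v (restr_pinv T w z *v y) = y)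
   \<and> restr_pinv T w z *v z = 0"
  unfolding restr_pinv_def by (rule theI') (use restr_pinv_exists restr_pinv_unique in blast)

lemma restr_pinv_left_inverse:
  assumes "y \<bullet> w = 0"
  shows "restr_pinv T w z *v (T *v y) = y"
proof -
  define d where "d = restr_pinv T w z *v (T *v y) - y"
  have "d \<bullet> w = 0" and "T *v d = 0"
    using restr_pinv_spec invariant[OF assms] assms
    by (simp_all add: d_def inner_diff_left matrix_vector_mult_diff_distrib)
  then show ?thesis
    using injective[of d] by (simp add: d_def)
qed

end

section \<open>Reduced resolvents\<close>

text \<open>In the paper's notation \<open>P (P M P - \<mu> I)\<^sup>+ P\<close>.\<close>

definition reduced_resolvent :: "real^'n^'n \<Rightarrow> real^'n \<Rightarrow> real^'n \<Rightarrow> real \<Rightarrow> real^'n^'n" where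
  "reduced_resolvent M u w \<mu> =
     (let P = oblique_proj u w in P ** restr_pinv (P ** M ** P - \<mu> *\<^sub>R mat 1) w u ** P)"

lemma reduced_resolvent_mult:
  fixes M :: "real^'n^'n"
  assumes Mu: "M *v u = k *\<^sub>R u" and wM: "w v* M = k *\<^sub>R w" and "u \<bullet> w \<noteq> 0"
    and not_eig: "\<not> restr_eigenvalue (oblique_proj u w ** M ** oblique_proj u w) w \<mu>"
  shows "reduced_resolvent M u w \<mu> *v ((M - \<mu> *\<^sub>R mat 1) *v x) = oblique_proj u w *v x"
proof -
  define P where "P = oblique_proj u w"
  define T where "T = P ** M ** P - \<mu> *\<^sub>R mat 1"
  have T_apply: "T *v y = P *v (M *v (P *v y)) - \<mu> *\<^sub>R y" for y
    by (simp add: T_def matrix_vector_mult_diff_rdistrib scaleR_matrix_vector_assoc[symmetric]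
        matrix_vector_mul_assoc matrix_mul_assoc)
  have invariant: "(T *v y) \<bullet> w = 0" if "y \<bullet> w = 0" for y
    using that \<open>u \<bullet> w \<noteq> 0\<close> by (simp add: T_apply P_def inner_diff_left oblique_proj_orthogonal)
  have injective: "y = 0" if "y \<bullet> w = 0" and "T *v y = 0" for y
    using not_eig that unfolding restr_eigenvalue_def
    by (auto simp: T_apply P_def matrix_vector_mul_assoc matrix_mul_assoc scalar_mult_eq_scaleR)
  have "reduced_resolvent M u w \<mu> *v ((M - \<mu> *\<^sub>R mat 1) *v x)
      = P *v (restr_pinv T w u *v (P *v ((M - \<mu> *\<^sub>R mat 1) *v x)))"
    by (simp add: reduced_resolvent_def Let_def P_def T_def matrix_vector_mul_assoc matrix_mul_assoc)
  also have "P *v ((M - \<mu> *\<^sub>R mat 1) *v x) = T *v (P *v x)"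
    using \<open>u \<bullet> w \<noteq> 0\<close>
    by (simp add: T_apply P_def oblique_proj_commute[OF Mu wM] oblique_proj_idem
        matrix_vector_mult_diff_rdistrib matrix_vector_mult_diff_distrib
        scaleR_matrix_vector_assoc[symmetric] matrix_vector_mult_scaleR)
  also have "restr_pinv T w u *v (T *v (P *v x)) = P *v x"
    using \<open>u \<bullet> w \<noteq> 0\<close> invariant injective
    by (intro restr_pinv_left_inverse) (simp_all add: P_def oblique_proj_orthogonal)
  finally show ?thesis
    using \<open>u \<bullet> w \<noteq> 0\<close> by (simp add: P_def oblique_proj_idem)
qed

lemma inner_transpose_mult: "y \<bullet> (transpose A *v z) = (A *v y) \<bullet> z" for A :: "real^'n^'m"
  by (metis dot_lmul_matrix inner_commute transpose_matrix_vector)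

lemma reduced_resolvent_error_identity:
  fixes M :: "real^'n^'n"
  assumes Mu: "M *v u = k *\<^sub>R u" and wM: "w v* M = k *\<^sub>R w" and "u \<bullet> w \<noteq> 0"
    and not_eig: "\<not> restr_eigenvalue (oblique_proj u w ** M ** oblique_proj u w) w \<mu>"
    and not_eig_transpose:
      "\<not> restr_eigenvalue (oblique_proj w u ** transpose M ** oblique_proj w u) u \<mu>"
  shows "((transpose M - \<mu> *\<^sub>R mat 1) *v v) \<bullet>
           ((transpose (reduced_resolvent (transpose M) w u \<mu>) ** (M - k *\<^sub>R mat 1)
             ** reduced_resolvent M u w \<mu>) *v ((M - \<mu> *\<^sub>R mat 1) *v x))
         = v \<bullet> ((M - k *\<^sub>R mat 1) *v x)"
proof -
  have right: "reduced_resolvent M u w \<mu> *v ((M - \<mu> *\<^sub>R mat 1) *v x) = oblique_proj u w *v x"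
    by (rule reduced_resolvent_mult[OF Mu wM \<open>u \<bullet> w \<noteq> 0\<close> not_eig])
  have left: "reduced_resolvent (transpose M) w u \<mu> *v ((transpose M - \<mu> *\<^sub>R mat 1) *v v)
      = oblique_proj w u *v v"
    using Mu wM \<open>u \<bullet> w \<noteq> 0\<close> not_eig_transpose
    by (intro reduced_resolvent_mult[where u = w and w = u and k = k]) (simp_all add: inner_commute)
  have "(M - k *\<^sub>R mat 1) *v u = 0"
    using Mu by (simp add: matrix_vector_mult_diff_rdistrib scaleR_matrix_vector_assoc[symmetric])
  then have kernel: "(M - k *\<^sub>R mat 1) *v (oblique_proj u w *v x) = (M - k *\<^sub>R mat 1) *v x"
    by (simp add: oblique_proj_apply matrix_vector_mult_diff_distrib matrix_vector_mult_scaleR)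
  have "w v* (M - k *\<^sub>R mat 1) = 0"
    using wM by (simp add: vector_matrix_mult_diff_rdistrib vector_scaleR_matrix_ac)
  then have cokernel: "w \<bullet> ((M - k *\<^sub>R mat 1) *v x) = 0"
    by (metis dot_lmul_matrix inner_zero_left)
  show ?thesis
    by (simp only: matrix_vector_mul_assoc[symmetric] inner_transpose_mult left right kernel)
      (simp add: oblique_proj_apply inner_diff_left cokernel)
qed

section \<open>The generalized eigenvalue problem\<close>

lemma
  assumes "invertible A"
  shows matrix_inv_right: "A ** matrix_inv A = mat 1"
    and matrix_inv_left: "matrix_inv A ** A = mat 1"
  using someI_ex[OF assms[unfolded invertible_def]] by (simp_all add: matrix_inv_def)

lemma abs_inner_mult_le_onorm:
  fixes C :: "real^'n^'m"
  shows "\<bar>y \<bullet> (C *v x)\<bar> \<le> onorm ((*v) C) * norm x * norm y"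
proof -
  have "\<bar>y \<bullet> (C *v x)\<bar> \<le> norm y * norm (C *v x)"
    by (rule Cauchy_Schwarz_ineq2)
  also have "\<dots> \<le> norm y * (onorm ((*v) C) * norm x)"
    by (intro mult_left_mono onorm) simp_all
  finally show ?thesis
    by (simp add: mult_ac)
qed

lemma pencil_right_eigenvector:
  assumes "invertible A" and "lam \<noteq> 0" and "A *v u = lam *s (B *v u)"
  shows "(matrix_inv A ** B) *v u = (1 / lam) *\<^sub>R u"
proof -
  have "B *v u = (1 / lam) *\<^sub>R (A *v u)"
    using assms(2,3) by (simp add: scalar_mult_eq_scaleR)
  then show ?thesis
    by (simp add: matrix_vector_mul_assoc[symmetric] matrix_vector_mult_scaleR
        matrix_vector_mul_assoc matrix_inv_left[OF assms(1)])
qed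

lemma pencil_left_eigenvector:
  assumes "invertible A" and "lam \<noteq> 0" and "transpose A *v y = lam *s (transpose B *v y)"
  shows "(y v* A) v* (matrix_inv A ** B) = (1 / lam) *\<^sub>R (y v* A)"
proof -
  have "y v* B = (1 / lam) *\<^sub>R (y v* A)"
    using assms(2,3) by (simp add: scalar_mult_eq_scaleR)
  then show ?thesis
    by (simp add: vector_matrix_mul_assoc matrix_mul_assoc matrix_inv_right[OF assms(1)])
qed

lemma pencil_rayleigh_quotient_error_bound:
  fixes A B :: "real^'n^'n"
  defines "M \<equiv> matrix_inv A ** B"
  assumes A_inv: "invertible A" and Mu: "M *v u = k *\<^sub>R u" and wM: "w v* M = k *\<^sub>R w"
    and "u \<bullet> w \<noteq> 0" and nz: "y \<bullet> (A *v x) \<noteq> 0" and rayleigh: "\<mu> = (y \<bullet> (B *v x)) / (y \<bullet> (A *v x))"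
    and not_eig: "\<not> restr_eigenvalue (oblique_proj u w ** M ** oblique_proj u w) w \<mu>"
    and not_eig_transpose: "\<not> restr_eigenvalue (oblique_proj w u ** transpose M ** oblique_proj w u) u \<mu>"
  shows "\<bar>\<mu> - k\<bar> \<le> onorm ((*v) (transpose (reduced_resolvent (transpose M) w u \<mu>) ** (M - k *\<^sub>R mat 1)
            ** reduced_resolvent M u w \<mu> ** matrix_inv A))
          * (norm ((B - \<mu> *\<^sub>R A) *v x) * norm ((transpose B - \<mu> *\<^sub>R transpose A) *v y)
             / \<bar>y \<bullet> (A *v x)\<bar>)"
proof -
  define a where "a = y \<bullet> (A *v x)"
  define C where "C = transpose (reduced_resolvent (transpose M) w u \<mu>) ** (M - k *\<^sub>R mat 1)
    ** reduced_resolvent M u w \<mu>"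
  define v where "v = y v* A"
  have AM: "A ** M = B"
    by (simp add: M_def matrix_mul_assoc matrix_inv_right[OF A_inv])
  have "(B - \<mu> *\<^sub>R A) *v x = A *v ((M - \<mu> *\<^sub>R mat 1) *v x)"
    by (simp add: AM[symmetric] matrix_vector_mult_diff_rdistrib matrix_vector_mult_diff_distrib
        scaleR_matrix_vector_assoc[symmetric] matrix_vector_mult_scaleR matrix_vector_mul_assoc)
  moreover have "matrix_inv A *v (A *v z) = z" for z
    by (simp add: matrix_vector_mul_assoc matrix_inv_left[OF A_inv])
  ultimately have "(C ** matrix_inv A) *v ((B - \<mu> *\<^sub>R A) *v x) = C *v ((M - \<mu> *\<^sub>R mat 1) *v x)"
    by (simp add: matrix_vector_mul_assoc[symmetric])
  moreover have "(transpose B - \<mu> *\<^sub>R transpose A) *v y = (transpose M - \<mu> *\<^sub>R mat 1) *v v"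
    by (simp add: v_def AM[symmetric] vector_matrix_mul_assoc matrix_vector_mult_diff_rdistrib
        scaleR_matrix_vector_assoc[symmetric])
  moreover have "v \<bullet> ((M - k *\<^sub>R mat 1) *v x) = (\<mu> - k) * a"
  proof -
    have "v \<bullet> (M *v x) = \<mu> * a" and "v \<bullet> x = a"
      using nz by (simp_all add: v_def dot_lmul_matrix AM[symmetric] matrix_vector_mul_assoc rayleigh a_def)
    then show ?thesis
      by (simp add: scaleR_matrix_vector_assoc[symmetric] algebra_simps)
  qed
  ultimately have "((transpose B - \<mu> *\<^sub>R transpose A) *v y) \<bullet> ((C ** matrix_inv A) *v ((B - \<mu> *\<^sub>R A) *v x))
      = (\<mu> - k) * a"
    using reduced_resolvent_error_identity[OF Mu wM \<open>u \<bullet> w \<noteq> 0\<close> not_eig not_eig_transpose]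
    by (simp add: C_def)
  then have "\<bar>\<mu> - k\<bar> * \<bar>a\<bar> \<le> onorm ((*v) (C ** matrix_inv A)) * norm ((B - \<mu> *\<^sub>R A) *v x)
      * norm ((transpose B - \<mu> *\<^sub>R transpose A) *v y)"
    using abs_inner_mult_le_onorm by (metis abs_mult)
  then show ?thesis
    using nz by (simp add: C_def a_def field_simps)
qed

theorem proposition2:
  fixes A B :: "real^'n^'n" and lam :: real and u us uN usN :: "real^'n"
  assumes A_inv: "invertible A"
    and lam_pos: "lam > 0"
    and lam_eig: "gen_eigenvalue A B (complex_of_real lam)"
    and lam_min: "\<And>mu. gen_eigenvalue A B mu \<Longrightarrow> cmod mu \<ge> lam"
    and lam_unique: "\<And>mu. gen_eigenvalue A B mu \<Longrightarrow> cmod mu = lam \<Longrightarrow> mu = complex_of_real lam"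
    and simple: "alg_simple_eigenvalue (matrix_inv A ** B) (1 / lam)"
    and u_unit: "norm u = 1" and u_eq: "A *v u = lam *s (B *v u)"
    and us_unit: "norm us = 1" and us_eq: "transpose A *v us = lam *s (transpose B *v us)"
    and nz: "usN \<bullet> (A *v uN) \<noteq> 0"
    and kN_P: "\<not> restr_eigenvalue
        (let M = matrix_inv A ** B; k = 1 / lam;
             ut = (1 / norm (transpose A *v us)) *s (transpose A *v us);
             P = mat 1 - (1 / (u \<bullet> ut)) *\<^sub>R outer u ut
         in P ** M ** P)
        ((1 / norm (transpose A *v us)) *s (transpose A *v us))
        ((usN \<bullet> (B *v uN)) / (usN \<bullet> (A *v uN)))"
    and kN_Ps: "\<not> restr_eigenvalue
        (let M = matrix_inv A ** B;
             ut = (1 / norm (transpose A *v us)) *s (transpose A *v us);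
             Ps = mat 1 - (1 / (u \<bullet> ut)) *\<^sub>R outer ut u
         in Ps ** transpose M ** Ps)
        u
        ((usN \<bullet> (B *v uN)) / (usN \<bullet> (A *v uN)))"
  shows
    "let M = matrix_inv A ** B; k = 1 / lam;
         ut = (1 / norm (transpose A *v us)) *s (transpose A *v us);
         P = mat 1 - (1 / (u \<bullet> ut)) *\<^sub>R outer u ut;
         Ps = mat 1 - (1 / (u \<bullet> ut)) *\<^sub>R outer ut u;
         kN = (usN \<bullet> (B *v uN)) / (usN \<bullet> (A *v uN));
         RN = (B - kN *\<^sub>R A) *v uN;
         RNs = (transpose B - kN *\<^sub>R transpose A) *v usN;
         X = restr_pinv (P ** M ** P - kN *\<^sub>R mat 1) ut u;
         Xs = restr_pinv (Ps ** transpose M ** Ps - kN *\<^sub>R mat 1) u ut;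
         CNk = onorm (\<lambda>x. (transpose (Ps ** Xs ** Ps) ** (M - k *\<^sub>R mat 1) ** P ** X ** P
                            ** matrix_inv A) *v x);
         etaNk = norm RN * norm RNs / \<bar>usN \<bullet> (A *v uN)\<bar>
     in \<bar>kN - k\<bar> \<le> CNk * etaNk"
proof -
  \<comment> \<open>Of the hypotheses on \<^term>\<open>lam\<close> only \<open>lam \<noteq> 0\<close> and the simplicity of \<open>1 / lam\<close> are needed.\<close>
  define M where "M = matrix_inv A ** B"
  define k where "k = 1 / lam"
  define w where "w = transpose A *v us"
  define ut where "ut = (1 / norm w) *s w"
  define kN where "kN = (usN \<bullet> (B *v uN)) / (usN \<bullet> (A *v uN))"
  have Mu: "M *v u = k *\<^sub>R u"
    using pencil_right_eigenvector[OF A_inv _ u_eq] lam_pos by (simp add: M_def k_def)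
  have "w v* M = k *\<^sub>R w"
    using pencil_left_eigenvector[OF A_inv _ us_eq] lam_pos by (simp add: M_def k_def w_def)
  then have utM: "ut v* M = k *\<^sub>R ut"
    by (simp add: ut_def scalar_mult_eq_scaleR scaleR_vector_matrix_assoc)
  have "w v* matrix_inv A = us"
    by (simp add: w_def vector_matrix_mul_assoc matrix_inv_right[OF A_inv])
  with us_unit have "ut \<noteq> 0"
    by (auto simp: ut_def scalar_mult_eq_scaleR)
  with Mu utM simple u_unit have "u \<bullet> ut \<noteq> 0"
    by (intro alg_simple_eigenvalue_eigenvectors_not_orthogonal[of M k]) (auto simp: M_def k_def)
  have P: "mat 1 - (1 / (u \<bullet> ut)) *\<^sub>R outer u ut = oblique_proj u ut"
    and Ps: "mat 1 - (1 / (u \<bullet> ut)) *\<^sub>R outer ut u = oblique_proj ut u"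
    by (simp_all add: oblique_proj_def inner_commute)
  show ?thesis
    using pencil_rayleigh_quotient_error_bound[OF A_inv Mu[unfolded M_def] utM[unfolded M_def]
        \<open>u \<bullet> ut \<noteq> 0\<close> nz refl] kN_P kN_Ps
    unfolding Let_def M_def[symmetric] k_def[symmetric] w_def[symmetric] ut_def[symmetric] kN_def[symmetric] P Ps
    by (simp add: reduced_resolvent_def Let_def matrix_mul_assoc)
qed

end
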